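(* Let $x^{*}$ be an arbitrary sparsest solution (i.e. an optimal solution) of the problem $(P_0)$: $\min_{x\in R^n}\|x\|_0$ subject to $\|y-Ax\|_2\le\epsilon$, $Bx\le b$, and let $S$ be the support of $x^{*}$. Let $I$ and $\bar I$ be the index sets of the active and inactive constraints of $Bx\le b$ at $x^{*}$, and let $M^{*}=\begin{bmatrix}A_S\\ B_{I,S}\end{bmatrix}$. Assume that $\mathrm{Null}(M^{*})=\{0\}$ and $\mathrm{Null}(B_{\bar I,S})=\{0\}$. (a) The problem $(P_0)$ has infinitely many optimal solutions with the same support as $x^{*}$ if one of the following conditions holds: (D1) $\{d:B_{I,S}d>0\}\cap\{d:A_Sd=0\}\ne\emptyset$. (D2) $\{d:B_{I,S}d<0\}\cap\{d:A_Sd=0\}\ne\emptyset$. (b) If the error vector $e^{*}=y-Ax^{*}$ satisfies $\|e^{*}\|_2<\epsilon$, then $(P_0)$ has infinitely many optimal solutions which have the same support as $x^{*}$ if one of the following conditions holds: (D3) $\mathrm{Null}(B_{I,S})\ne\{0\}$. (D4) $\{d:B_{I,S}d>0\}\cap\{d:A_Sd\ne0\}\ne\emptyset$. (D5) $\{d:B_{I,S}d<0\}\cap\{d:A_Sd\ne0\}\ne\emptyset$.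
   Context: Data: $A\in R^{m\times n}$, $B\in R^{l\times n}$ with $m\ll n$ (in particular $m<n$) and $l\le n$; $y\in R^m$, $b\in R^l$ are given vectors and $\epsilon\ge 0$ is a given parameter. $\|x\|_0$ is the number of nonzero components of $x$; $\|\cdot\|_2$ is the Euclidean norm; vector inequalities ($\le$, $<$, $>$) are understood componentwise. The support of $x$ is $\mathrm{supp}(x)=\{i:x_i\neq0\}$. The active index set is $I=\{j\in\{1,\dots,l\}:(Bx^{*})_j=b_j\}$ and $\bar I=\{1,\dots,l\}\setminus I$. For an index set $S$ of columns, $A_S$ is the submatrix of $A$ consisting of the columns indexed by $S$; for an index set $J$ of rows, $B_{J,S}$ is the submatrix of $B$ with rows indexed by $J$ and columns indexed by $S$. $\mathrm{Null}(\cdot)$ denotes the null space. Vectors $d$ range over $R^{|S|}$.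
   Formalization: Part (a) additionally assumes that the active index set I is nonempty; if I is empty, d=0 satisfies (D1) and (D2) vacuously and the claim can fail (e.g. A=[1 0], y=1, ε=0, B=[1 0], b=5). *)

theory Defs
  imports "HOL-Analysis.Analysis"
begin

definition supp :: "real ^ 'n \<Rightarrow> 'n set" where
  "supp x = {i. x $ i \<noteq> 0}"

definition l0_norm :: "real ^ 'n \<Rightarrow> nat" where
  "l0_norm x = card (supp x)"

(* The order \<le> on real ^ 'l is the componentwise one. *)
definition feasible ::
  "real ^ 'n ^ 'm \<Rightarrow> real ^ 'n ^ 'l \<Rightarrow> real ^ 'm \<Rightarrow> real ^ 'l \<Rightarrow> real \<Rightarrow> real ^ 'n \<Rightarrow> bool" where
  "feasible A B y b \<epsilon> x \<longleftrightarrow> norm (y - A *v x) \<le> \<epsilon> \<and> B *v x \<le> b"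

definition optimal ::
  "real ^ 'n ^ 'm \<Rightarrow> real ^ 'n ^ 'l \<Rightarrow> real ^ 'm \<Rightarrow> real ^ 'l \<Rightarrow> real \<Rightarrow> real ^ 'n \<Rightarrow> bool" where
  "optimal A B y b \<epsilon> x \<longleftrightarrow> is_arg_min l0_norm (feasible A B y b \<epsilon>) x"

definition active :: "real ^ 'n ^ 'l \<Rightarrow> real ^ 'l \<Rightarrow> real ^ 'n \<Rightarrow> 'l set" where
  "active B b x = {j. (B *v x) $ j = b $ j}"

(* For a finite index set S, the space R^|S| is represented by the functions on S that are
   extensional (undefined outside S), so that equality of functions is equality of vectors. *)
definition vecs :: "'i set \<Rightarrow> ('i \<Rightarrow> real) set" where
  "vecs S = S \<rightarrow>\<^sub>E UNIV"

definition zero_vec :: "'i set \<Rightarrow> 'i \<Rightarrow> real" where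
  "zero_vec S = (\<lambda>i\<in>S. 0)"

(* Multiplication by the submatrix of M with rows J and columns S: a map from
   vecs S to vecs J. *)
definition submat_mult ::
  "real ^ 'n ^ 'r \<Rightarrow> 'r set \<Rightarrow> 'n set \<Rightarrow> ('n \<Rightarrow> real) \<Rightarrow> 'r \<Rightarrow> real" where
  "submat_mult M J S d = (\<lambda>i\<in>J. \<Sum>j\<in>S. M $ i $ j * d j)"

definition submat_null :: "real ^ 'n ^ 'r \<Rightarrow> 'r set \<Rightarrow> 'n set \<Rightarrow> ('n \<Rightarrow> real) set" where
  "submat_null M J S = {d \<in> vecs S. submat_mult M J S d = zero_vec J}"

(* The block matrix with the rows of A on top of those of B.  Its submatrix with rows
   UNIV <+> I and columns S has the blocks A_S and B_{I,S}. *)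
definition stack :: "real ^ 'n ^ 'm \<Rightarrow> real ^ 'n ^ 'l \<Rightarrow> real ^ 'n ^ ('m + 'l)" where
  "stack A B = (\<chi> r. case r of Inl i \<Rightarrow> A $ i | Inr j \<Rightarrow> B $ j)"

(* Strict inequality in every component.  The library's < on vectors is only the strict part
   of \<le>.  Over an empty index set J the relation holds vacuously. *)
definition strictly_less :: "'i set \<Rightarrow> ('i \<Rightarrow> real) \<Rightarrow> ('i \<Rightarrow> real) \<Rightarrow> bool" where
  "strictly_less J u v \<longleftrightarrow> (\<forall>i\<in>J. u i < v i)"

end

theory Submission
  imports Defs
begin

text \<open>
  A direction \<open>v \<noteq> 0\<close> supported in \<open>S\<close> along which no active constraint increases and along which
  the residual bound survives (because \<open>A v = 0\<close>, or because the bound is strict) keeps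
  \<open>xstar + t v\<close> feasible with support \<open>S\<close> for all small \<open>t > 0\<close>. Sparsity being the objective,
  all these points are optimal. Each of (D1) to (D5) provides such a direction, up to sign.
\<close>

text \<open>The objective \<open>l0_norm\<close> sees a point only through its support, so the
  feasible point \<open>z\<close> attains the same minimal value as \<open>x\<close>.\<close>

lemma optimal_if_same_support:
  assumes "optimal A B y b \<epsilon> x" "feasible A B y b \<epsilon> z" "supp z = supp x"
  shows "optimal A B y b \<epsilon> z"
  using assms by (simp add: optimal_def is_arg_min_def l0_norm_def)

text \<open>Turns an "eventually" statement into infinitude: \<open>P\<close> holds on a whole
  interval of small positive parameters, and since \<open>v\<close> is nonzero, distinct parameters
  give distinct points.\<close>

lemma infinite_ray_at_right:
  fixes x v :: "'a :: real_vector"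
  assumes "eventually (\<lambda>t::real. P (x + t *\<^sub>R v)) (at_right 0)" "v \<noteq> 0"
  shows "infinite {z. P z}"
proof -
  obtain \<delta> :: real where \<delta>: "0 < \<delta>" "\<And>t. 0 < t \<Longrightarrow> t < \<delta> \<Longrightarrow> P (x + t *\<^sub>R v)"
    using assms(1) by (auto simp: eventually_at_right_field)
  have "inj_on (\<lambda>t. x + t *\<^sub>R v) {0<..<\<delta>}"
    using \<open>v \<noteq> 0\<close> by (auto simp: inj_on_def)
  moreover have "infinite {0<..<\<delta>}"
    using \<delta>(1) by (rule infinite_Ioo)
  ultimately have "infinite ((\<lambda>t. x + t *\<^sub>R v) ` {0<..<\<delta>})"
    using finite_imageD by blast
  moreover have "(\<lambda>t. x + t *\<^sub>R v) ` {0<..<\<delta>} \<subseteq> {z. P z}"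
    using \<delta>(2) by auto
  ultimately show ?thesis
    using finite_subset by blast
qed

text \<open>Coordinates vanishing at \<open>x\<close> vanish in \<open>v\<close> too and stay zero;
  the others stay nonzero by continuity. As there are finitely many coordinates, one threshold for
  \<open>t\<close> serves all of them.\<close>

lemma eventually_supp_add_eq:
  assumes "supp v \<subseteq> supp x"
  shows "eventually (\<lambda>t::real. supp (x + t *\<^sub>R v) = supp x) (at_right 0)"
proof -
  have "eventually (\<lambda>t::real. (x + t *\<^sub>R v) $ i \<noteq> 0 \<longleftrightarrow> x $ i \<noteq> 0) (at_right 0)" for i
  proof (cases "x $ i = 0")
    case True
    then have "v $ i = 0"
      using assms by (auto simp: supp_def)
    with True show ?thesis by simp
  next
    case False
    have "((\<lambda>t::real. (x + t *\<^sub>R v) $ i) \<longlongrightarrow> x $ i) (at_right 0)"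
      by (auto intro!: tendsto_eq_intros)
    from tendsto_imp_eventually_ne[OF this False] False show ?thesis by simp
  qed
  then have "eventually (\<lambda>t::real. \<forall>i. (x + t *\<^sub>R v) $ i \<noteq> 0 \<longleftrightarrow> x $ i \<noteq> 0) (at_right 0)"
    by (rule eventually_all_finite)
  then show ?thesis
    by eventually_elim (auto simp: supp_def)
qed

text \<open>An active constraint starts at equality and changes by \<open>t * (B *v v) $ i\<close>,
  which is nonpositive because the filter is restricted to \<open>t > 0\<close>. An inactive
  constraint has slack, which survives a small step by continuity. The residual either does not
  change or has slack of its own.\<close>

lemma eventually_feasible_add:
  assumes "feasible A B y b \<epsilon> x"
    and "\<And>i. i \<in> active B b x \<Longrightarrow> (B *v v) $ i \<le> 0"
    and "A *v v = 0 \<or> norm (y - A *v x) < \<epsilon>"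
  shows "eventually (\<lambda>t::real. feasible A B y b \<epsilon> (x + t *\<^sub>R v)) (at_right 0)"
proof -
  have A: "A *v (x + t *\<^sub>R v) = A *v x + t *\<^sub>R (A *v v)" for t :: real
    by (simp add: matrix_vector_right_distrib matrix_vector_mult_scaleR)
  have B: "(B *v (x + t *\<^sub>R v)) $ i = (B *v x) $ i + t * (B *v v) $ i" for t :: real and i
    by (simp add: matrix_vector_right_distrib matrix_vector_mult_scaleR)
  have le: "(B *v x) $ i \<le> b $ i" for i
    using assms(1) by (simp add: feasible_def less_eq_vec_def)
  have "eventually (\<lambda>t::real. (B *v (x + t *\<^sub>R v)) $ i \<le> b $ i) (at_right 0)" for i
  proof (cases "i \<in> active B b x")
    case True
    have "eventually (\<lambda>t::real. t > 0) (at_right 0)"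
      by (rule eventually_at_right_less)
    then show ?thesis
    proof eventually_elim
      case (elim t)
      then have "t * (B *v v) $ i \<le> 0"
        using assms(2)[OF True] by (simp add: mult_nonneg_nonpos)
      then show ?case
        using le[of i] B[of t i] by linarith
    qed
  next
    case False
    then have "(B *v x) $ i < b $ i"
      using le[of i] by (simp add: active_def)
    moreover have "((\<lambda>t::real. (B *v (x + t *\<^sub>R v)) $ i) \<longlongrightarrow> (B *v x) $ i) (at_right 0)"
      unfolding B by (auto intro!: tendsto_eq_intros)
    ultimately have "eventually (\<lambda>t::real. (B *v (x + t *\<^sub>R v)) $ i < b $ i) (at_right 0)"
      by (auto dest: order_tendstoD)
    then show ?thesis
      by eventually_elim simp
  qed
  then have Bev: "eventually (\<lambda>t::real. \<forall>i. (B *v (x + t *\<^sub>R v)) $ i \<le> b $ i) (at_right 0)"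
    by (rule eventually_all_finite)
  have "eventually (\<lambda>t::real. norm (y - A *v (x + t *\<^sub>R v)) \<le> \<epsilon>) (at_right 0)"
    using assms(3)
  proof
    assume "A *v v = 0"
    then show ?thesis
      using assms(1) by (simp add: A feasible_def)
  next
    assume less: "norm (y - A *v x) < \<epsilon>"
    have "((\<lambda>t::real. norm (y - A *v (x + t *\<^sub>R v))) \<longlongrightarrow> norm (y - A *v x)) (at_right 0)"
      unfolding A by (auto intro!: tendsto_eq_intros)
    from order_tendstoD(2)[OF this less] show ?thesis
      by eventually_elim simp
  qed
  with Bev show ?thesis
    by eventually_elim (simp add: feasible_def less_eq_vec_def)
qed

lemma infinite_optimal_if_direction:
  assumes opt: "optimal A B y b \<epsilon> x"
    and "v \<noteq> 0" "supp v \<subseteq> supp x"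
    and "\<And>i. i \<in> active B b x \<Longrightarrow> (B *v v) $ i \<le> 0"
    and "A *v v = 0 \<or> norm (y - A *v x) < \<epsilon>"
  shows "infinite {z. optimal A B y b \<epsilon> z \<and> supp z = supp x}"
proof (rule infinite_ray_at_right)
  have "feasible A B y b \<epsilon> x"
    using opt by (simp add: optimal_def is_arg_min_def)
  then have "eventually (\<lambda>t. feasible A B y b \<epsilon> (x + t *\<^sub>R v)) (at_right 0)"
    using assms(4,5) by (rule eventually_feasible_add)
  with eventually_supp_add_eq[OF assms(3)]
  show "eventually (\<lambda>t. optimal A B y b \<epsilon> (x + t *\<^sub>R v) \<and> supp (x + t *\<^sub>R v) = supp x) (at_right 0)"
    by eventually_elim (auto intro: optimal_if_same_support[OF opt])
qed (fact \<open>v \<noteq> 0\<close>)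

text \<open>Embeds the space of vectors indexed by \<open>S\<close> into the full space, so that the
  submatrix conditions become statements about ordinary products with \<open>A\<close> and
  \<open>B\<close>.\<close>

definition extend_zero :: "'n set \<Rightarrow> ('n \<Rightarrow> real) \<Rightarrow> real ^ 'n" where
  "extend_zero S d = (\<chi> i. if i \<in> S then d i else 0)"

lemma supp_extend_zero: "supp (extend_zero S d) \<subseteq> S"
  by (auto simp: supp_def extend_zero_def)

text \<open>The padded zeros cancel the columns outside \<open>S\<close>; the row set
  \<open>J\<close> only selects which entries of the product are kept.\<close>

lemma submat_mult_eq_extend_zero:
  "submat_mult M J S d = (\<lambda>i\<in>J. (M *v extend_zero S d) $ i)"
  by (auto simp: submat_mult_def extend_zero_def matrix_vector_mult_def if_distrib
      sum.If_cases cong: if_cong)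

lemma submat_mult_UNIV_eq_zero_iff:
  "submat_mult M UNIV S d = zero_vec UNIV \<longleftrightarrow> M *v extend_zero S d = 0"
  by (auto simp: submat_mult_eq_extend_zero zero_vec_def fun_eq_iff vec_eq_iff)

text \<open>Padding forgets the values of \<open>d\<close> outside \<open>S\<close>; membership in
  \<open>vecs S\<close> fixes them, so that vanishing on \<open>S\<close> determines
  \<open>d\<close>.\<close>

lemma extend_zero_eq_0_iff:
  assumes "d \<in> vecs S"
  shows "extend_zero S d = 0 \<longleftrightarrow> d = zero_vec S"
  using assms
  by (auto simp: vecs_def extend_zero_def zero_vec_def vec_eq_iff fun_eq_iff PiE_def extensional_def)

text \<open>Common interface for all five conditions. The weak signs cover both the strict
  inequalities and null vectors. For nonnegative products the direction is negated, which affects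
  neither its support nor the residual condition.\<close>

lemma infinite_optimal_if_submat_direction:
  assumes opt: "optimal A B y b \<epsilon> x"
    and ne: "extend_zero (supp x) d \<noteq> 0"
    and signs: "(\<forall>i \<in> active B b x. submat_mult B (active B b x) (supp x) d i \<ge> 0) \<or>
           (\<forall>i \<in> active B b x. submat_mult B (active B b x) (supp x) d i \<le> 0)"
    and res: "A *v extend_zero (supp x) d = 0 \<or> norm (y - A *v x) < \<epsilon>"
  shows "infinite {z. optimal A B y b \<epsilon> z \<and> supp z = supp x}"
proof -
  let ?v = "extend_zero (supp x) d"
  have supp_neg: "supp (- ?v) \<subseteq> supp x"
    using supp_extend_zero[of "supp x" d] by (simp add: supp_def)
  from signs show ?thesis
  proof
    assume "\<forall>i \<in> active B b x. submat_mult B (active B b x) (supp x) d i \<ge> 0"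
    then show ?thesis
      using ne res supp_neg
      by (intro infinite_optimal_if_direction[OF opt, of "- ?v"])
        (auto simp: submat_mult_eq_extend_zero linear_neg[OF matrix_vector_mul_linear])
  next
    assume "\<forall>i \<in> active B b x. submat_mult B (active B b x) (supp x) d i \<le> 0"
    then show ?thesis
      using ne res supp_extend_zero
      by (intro infinite_optimal_if_direction[OF opt, of ?v])
        (auto simp: submat_mult_eq_extend_zero)
  qed
qed

theorem theorem3p2:
  fixes A :: "real ^ 'n ^ 'm" and B :: "real ^ 'n ^ 'l"
    and y :: "real ^ 'm" and b :: "real ^ 'l" and \<epsilon> :: real
    and xstar :: "real ^ 'n" and S :: "'n set" and I :: "'l set"
  assumes "CARD('m) < CARD('n)" and "CARD('l) \<le> CARD('n)" and "\<epsilon> \<ge> 0"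
    and "optimal A B y b \<epsilon> xstar"
    and "S = supp xstar" and "I = active B b xstar"
    and "submat_null (stack A B) (UNIV <+> I) S = {zero_vec S}"
    and "submat_null B (- I) S = {zero_vec S}"
  shows "(I \<noteq> {} \<and>
          ({d \<in> vecs S. strictly_less I (zero_vec I) (submat_mult B I S d)}
             \<inter> {d \<in> vecs S. submat_mult A UNIV S d = zero_vec UNIV} \<noteq> {} \<or>
           {d \<in> vecs S. strictly_less I (submat_mult B I S d) (zero_vec I)}
             \<inter> {d \<in> vecs S. submat_mult A UNIV S d = zero_vec UNIV} \<noteq> {})
          \<longrightarrow> infinite {x. optimal A B y b \<epsilon> x \<and> supp x = S})
       \<and> (norm (y - A *v xstar) < \<epsilon> \<and>
          (submat_null B I S \<noteq> {zero_vec S} \<or>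
           {d \<in> vecs S. strictly_less I (zero_vec I) (submat_mult B I S d)}
             \<inter> {d \<in> vecs S. submat_mult A UNIV S d \<noteq> zero_vec UNIV} \<noteq> {} \<or>
           {d \<in> vecs S. strictly_less I (submat_mult B I S d) (zero_vec I)}
             \<inter> {d \<in> vecs S. submat_mult A UNIV S d \<noteq> zero_vec UNIV} \<noteq> {})
          \<longrightarrow> infinite {x. optimal A B y b \<epsilon> x \<and> supp x = S})"
proof -
  note opt = \<open>optimal A B y b \<epsilon> xstar\<close>
  note S = \<open>S = supp xstar\<close> and I = \<open>I = active B b xstar\<close>
  note infI = infinite_optimal_if_submat_direction[OF opt, folded S I]
  have a: "infinite {x. optimal A B y b \<epsilon> x \<and> supp x = S}"
    if "I \<noteq> {}" and "submat_mult A UNIV S d = zero_vec UNIV"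
      and d: "strictly_less I (zero_vec I) (submat_mult B I S d) \<or>
        strictly_less I (submat_mult B I S d) (zero_vec I)" for d
  proof (rule infI)
    \<comment> \<open>An active row on which the product is nonzero excludes the zero direction.
      This is where \<open>I\<close> must be nonempty: over an empty \<open>I\<close> the strict
      inequalities hold vacuously, even for the zero vector.\<close>
    show "extend_zero S d \<noteq> 0"
      using d \<open>I \<noteq> {}\<close>
      by (auto simp: strictly_less_def zero_vec_def submat_mult_eq_extend_zero)
    show "A *v extend_zero S d = 0 \<or> norm (y - A *v xstar) < \<epsilon>"
      using that(2) by (simp add: submat_mult_UNIV_eq_zero_iff)
  qed (use d in \<open>auto simp: strictly_less_def zero_vec_def intro: less_imp_le\<close>)
  have b: "infinite {x. optimal A B y b \<epsilon> x \<and> supp x = S}"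
    if "norm (y - A *v xstar) < \<epsilon>" and "submat_mult A UNIV S d \<noteq> zero_vec UNIV"
      and "strictly_less I (zero_vec I) (submat_mult B I S d) \<or>
        strictly_less I (submat_mult B I S d) (zero_vec I)" for d
  proof (rule infI)
    \<comment> \<open>For (D4) and (D5) the direction is nonzero because its image under
      \<open>A\<close> is; the strict residual bound absorbs this change of the residual.\<close>
    show "extend_zero S d \<noteq> 0"
      using that(2) by (auto simp: submat_mult_UNIV_eq_zero_iff)
  qed (use that in \<open>auto simp: strictly_less_def zero_vec_def intro: less_imp_le\<close>)
  have c: "infinite {x. optimal A B y b \<epsilon> x \<and> supp x = S}"
    if "norm (y - A *v xstar) < \<epsilon>" and null: "submat_null B I S \<noteq> {zero_vec S}"
  proof -
    \<comment> \<open>For (D3): a null space always contains zero, so differing from the singleton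
      means having a nonzero element. Moving along it leaves every active constraint at
      equality.\<close>
    have "zero_vec S \<in> submat_null B I S"
      by (auto simp: submat_null_def vecs_def zero_vec_def submat_mult_def)
    with null obtain d where d: "d \<in> submat_null B I S" "d \<noteq> zero_vec S"
      by blast
    then have "extend_zero S d \<noteq> 0"
      by (simp add: submat_null_def extend_zero_eq_0_iff)
    then show ?thesis
      by (rule infI) (use d that(1) in \<open>auto simp: submat_null_def zero_vec_def\<close>)
  qed
  show ?thesis
    using a b c by blast
qed

end
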